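(* Let $d\geq 2$ be an integer, let $K_{d+1}$ be the complete graph on the vertex set $V=[d+1]$, and let $p^{\triangle}:V\to\mathbb{R}^d$ be a bijection from $V$ onto the vertex set of a regular $d$-dimensional simplex in $\mathbb{R}^d$. Then the spectrum (eigenvalues with multiplicities) of the stiffness matrix $L(K_{d+1},p^{\triangle})$ is \[ \left\{0^{(d(d+1)/2)},\;1^{((d+1)(d-2)/2)},\;\left(\tfrac{d+1}{2}\right)^{(d)},\;(d+1)^{(1)}\right\}, \] where the superscript $(m)$ indicates multiplicity $m$.
   Context: For a graph $G=(V,E)$ and a map $p:V\to\mathbb{R}^d$, for distinct $u,v\in V$ let $d_{uv}=\frac{p(u)-p(v)}{\|p(u)-p(v)\|}$ if $p(u)\neq p(v)$ and $d_{uv}=0$ otherwise. The normalized rigidity matrix $R(G,p)$ is the $d|V|\times|E|$ real matrix whose column indexed by the edge $\{u,v\}$ is $(1_u-1_v)\otimes d_{uv}$, where $\{1_u\}_{u\in V}$ is the standard basis of $\mathbb{R}^{|V|}$ and $\otimes$ is the Kronecker product. The stiffness matrix is $L(G,p)=R(G,p)R(G,p)^t\in\mathbb{R}^{d|V|\times d|V|}$. *)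

theory Defs
  imports
    "Jordan_Normal_Form.Char_Poly"
    "Jordan_Normal_Form.VS_Connect"
begin

text \<open>
  Points of \<open>R^d\<close> are real vectors in \<^term>\<open>carrier_vec d\<close>.  A framework is given by a
  number \<open>n\<close> of vertices \<open>0, ..., n - 1\<close>, a map \<open>p\<close> from vertices to points, and a list of
  edges, one pair \<open>(u, v)\<close> for each edge \<open>{u, v}\<close>.  The order of the list is the order of the
  columns of the rigidity matrix.
\<close>

definition euclid_norm :: "real vec \<Rightarrow> real" where
  "euclid_norm x = sqrt (x \<bullet> x)"

definition kron_vec :: "'a :: times vec \<Rightarrow> 'a vec \<Rightarrow> 'a vec" where
  "kron_vec x y = vec (dim_vec x * dim_vec y)
     (\<lambda>k. x $ (k div dim_vec y) * y $ (k mod dim_vec y))"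

definition edge_dir :: "nat \<Rightarrow> (nat \<Rightarrow> real vec) \<Rightarrow> nat \<Rightarrow> nat \<Rightarrow> real vec" where
  "edge_dir d p u v =
     (if p u \<noteq> p v then (1 / euclid_norm (p u - p v)) \<cdot>\<^sub>v (p u - p v) else 0\<^sub>v d)"

text \<open>
  The column of an edge does not depend on the order of its end points: exchanging \<open>u\<close> and
  \<open>v\<close> changes the sign of both factors.
\<close>

definition edge_column :: "nat \<Rightarrow> nat \<Rightarrow> (nat \<Rightarrow> real vec) \<Rightarrow> nat \<times> nat \<Rightarrow> real vec" where
  "edge_column d n p = (\<lambda>(u, v). kron_vec (unit_vec n u - unit_vec n v) (edge_dir d p u v))"

definition rigidity_matrix ::
  "nat \<Rightarrow> nat \<Rightarrow> (nat \<times> nat) list \<Rightarrow> (nat \<Rightarrow> real vec) \<Rightarrow> real mat" where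
  "rigidity_matrix d n es p = mat_of_cols (d * n) (map (edge_column d n p) es)"

definition stiffness_matrix ::
  "nat \<Rightarrow> nat \<Rightarrow> (nat \<times> nat) list \<Rightarrow> (nat \<Rightarrow> real vec) \<Rightarrow> real mat" where
  "stiffness_matrix d n es p =
     rigidity_matrix d n es p * transpose_mat (rigidity_matrix d n es p)"

definition complete_edges :: "nat \<Rightarrow> nat set set" where
  "complete_edges n = {{u, v} | u v. u < n \<and> v < n \<and> u \<noteq> v}"

text \<open>Each edge is listed exactly once, in one of its two orientations.\<close>

definition enumerates_edges :: "(nat \<times> nat) list \<Rightarrow> nat set set \<Rightarrow> bool" where
  "enumerates_edges es E \<longleftrightarrow>
     distinct (map (\<lambda>(u, v). {u, v}) es) \<and> set (map (\<lambda>(u, v). {u, v}) es) = E"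

definition affinely_independent :: "nat \<Rightarrow> real vec set \<Rightarrow> bool" where
  "affinely_independent d S \<longleftrightarrow>
     (\<forall>x\<in>S. \<not> module.lin_dep class_ring (module_vec TYPE(real) d) ((\<lambda>y. y - x) ` (S - {x})))"

text \<open>
  \<open>S\<close> is the vertex set of a regular \<open>d\<close>-dimensional simplex in \<open>R^d\<close>: a simplex is
  regular when all of its edges have the same length.
\<close>

definition regular_simplex_vertices :: "nat \<Rightarrow> real vec set \<Rightarrow> bool" where
  "regular_simplex_vertices d S \<longleftrightarrow>
     S \<subseteq> carrier_vec d \<and> card S = d + 1 \<and> affinely_independent d S \<and>
     (\<exists>l. \<forall>x\<in>S. \<forall>y\<in>S. x \<noteq> y \<longrightarrow> euclid_norm (x - y) = l)"

text \<open>
  Eigenvalues with (algebraic) multiplicities.  Only real eigenvalues are listed, which are all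
  of them for a real symmetric matrix such as a stiffness matrix.
\<close>

definition spectrum_mset :: "real mat \<Rightarrow> real multiset" where
  "spectrum_mset A = proots (char_poly A)"

end

theory Submission
  imports Defs
begin

text \<open>
  Write \<open>n = d + 1\<close>, and let \<open>R\<close> be the rigidity matrix and \<open>B\<close> the unsigned vertex-edge
  incidence matrix of the complete graph on \<open>n\<close> vertices.  Adjacent edges of a regular simplex
  meet at an angle of 60 degrees and opposite edges contribute orthogonal columns, so
  \<open>R\<^sup>T R = 1 + B\<^sup>T B / 2\<close>.  Moreover \<open>B B\<^sup>T = (n - 2) 1 + J\<close> with \<open>J\<close> the all-ones matrix, which is
  a column times a row.  Applying \<open>x\<^sup>m det (x - X Y) = x\<^sup>n det (x - Y X)\<close> to \<open>R R\<^sup>T\<close>, to \<open>B\<^sup>T B\<close> and to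
  \<open>J\<close> reduces the characteristic polynomial of \<open>R R\<^sup>T\<close> to a product of linear factors, without
  computing any eigenvector.
\<close>

section \<open>Determinants\<close>

text \<open>The block matrix \<open>M\<close> has its determinant evaluated twice: \<open>N\<close>,
  of determinant 1, clears its lower left block from the right, and \<open>N'\<close>, of
  determinant \<open>x ^ m\<close>, clears it from the left. No division by \<open>x\<close> occurs,
  so \<open>x = 0\<close> is covered.\<close>

lemma det_sylvester:
  fixes x :: "'a :: idom"
  assumes A: "A \<in> carrier_mat n m" and B: "B \<in> carrier_mat m n"
  shows "x ^ m * det (x \<cdot>\<^sub>m 1\<^sub>m n - A * B) = x ^ n * det (x \<cdot>\<^sub>m 1\<^sub>m m - B * A)"
proof -
  define M where "M = four_block_mat (x \<cdot>\<^sub>m 1\<^sub>m n) A B (1\<^sub>m m)"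
  define N where "N = four_block_mat (1\<^sub>m n) (0\<^sub>m n m) (- B) (1\<^sub>m m)"
  define N' where "N' = four_block_mat (1\<^sub>m n) (0\<^sub>m n m) (- B) (x \<cdot>\<^sub>m 1\<^sub>m m)"
  have M: "M \<in> carrier_mat (n + m) (n + m)" and N: "N \<in> carrier_mat (n + m) (n + m)"
    and N': "N' \<in> carrier_mat (n + m) (n + m)"
    using A B by (auto simp: M_def N_def N'_def)
  have AB: "A * B \<in> carrier_mat n n" and BA: "B * A \<in> carrier_mat m m"
    using A B by auto
  have neg: "A * (- B) = - (A * B)" "(- B) * A = - (B * A)"
    using A B by simp_all
  have blocks: "x \<cdot>\<^sub>m 1\<^sub>m n + - (A * B) = x \<cdot>\<^sub>m 1\<^sub>m n - A * B" "B + - B = 0\<^sub>m m n"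
    "- (B * (x \<cdot>\<^sub>m 1\<^sub>m n)) + x \<cdot>\<^sub>m 1\<^sub>m m * B = 0\<^sub>m m n"
    "- (B * A) + x \<cdot>\<^sub>m 1\<^sub>m m = x \<cdot>\<^sub>m 1\<^sub>m m - B * A"
    using A B by (auto intro!: eq_matI simp: mult_smult_distrib[of _ m n]
        mult_smult_assoc_mat[of _ m m] right_mult_one_mat[of _ m n])
  have "M * N = four_block_mat (x \<cdot>\<^sub>m 1\<^sub>m n - A * B) A (0\<^sub>m m n) (1\<^sub>m m)"
    unfolding M_def N_def
    using A B by (simp add: mult_four_block_mat[where ?nr1.0=n and ?nr2.0=m and ?n1.0=n and ?n2.0=m
          and ?nc1.0=n and ?nc2.0=m] neg blocks)
  then have "det (M * N) = det (x \<cdot>\<^sub>m 1\<^sub>m n - A * B)"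
    using det_four_block_mat_lower_left_zero[OF minus_carrier_mat[OF AB] A refl one_carrier_mat]
    by simp
  moreover have "det N = 1"
    unfolding N_def using B by (simp add: det_four_block_mat_upper_right_zero[where n=n and m=m])
  ultimately have l: "det M = det (x \<cdot>\<^sub>m 1\<^sub>m n - A * B)"
    using det_mult[OF M N] by simp
  have "N' * M = four_block_mat (x \<cdot>\<^sub>m 1\<^sub>m n) A (0\<^sub>m m n) (x \<cdot>\<^sub>m 1\<^sub>m m - B * A)"
    unfolding M_def N'_def
    using A B by (simp add: mult_four_block_mat[where ?nr1.0=n and ?nr2.0=m and ?n1.0=n and ?n2.0=m
          and ?nc1.0=n and ?nc2.0=m] neg blocks)
  then have "det (N' * M) = x ^ n * det (x \<cdot>\<^sub>m 1\<^sub>m m - B * A)"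
    using det_four_block_mat_lower_left_zero[OF smult_carrier_mat[OF one_carrier_mat] A refl
        minus_carrier_mat[OF BA]]
    by simp
  moreover have "det N' = x ^ m"
    unfolding N'_def using B by (simp add: det_four_block_mat_upper_right_zero[where n=n and m=m])
  ultimately show ?thesis
    using det_mult[OF N' M] l by simp
qed

lemma poly_char_poly:
  fixes A :: "'a :: field mat"
  assumes A: "A \<in> carrier_mat n n"
  shows "poly (char_poly A) x = det (x \<cdot>\<^sub>m 1\<^sub>m n - A)"
  unfolding char_poly_matrix[OF A]
  by (rule arg_cong[of _ _ det]) (use A in \<open>auto simp: char_matrix_def\<close>)

text \<open>The all-ones matrix is a column of ones times its transpose, so
  \<open>det_sylvester\<close> leads to a 1 by 1 determinant; the leading factor \<open>x\<close> is
  its \<open>x ^ m\<close> with \<open>m = 1\<close>.\<close>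

lemma det_all_ones:
  fixes x :: "'a :: idom"
  shows "x * det (x \<cdot>\<^sub>m 1\<^sub>m n - mat n n (\<lambda>_. 1)) = x ^ n * (x - of_nat n)"
proof -
  define K :: "'a mat" where "K = mat n 1 (\<lambda>_. 1)"
  have K: "K \<in> carrier_mat n 1" and K': "transpose_mat K \<in> carrier_mat 1 n"
    by (auto simp: K_def)
  have "mat n n (\<lambda>_. 1) = K * transpose_mat K"
    by (rule eq_matI) (auto simp: K_def scalar_prod_def)
  moreover have "det (x \<cdot>\<^sub>m 1\<^sub>m 1 - transpose_mat K * K) = x - of_nat n"
    by (subst det_single) (auto simp: K_def scalar_prod_def)
  ultimately show ?thesis
    using det_sylvester[OF K K', of x] by simp
qed

section \<open>Complete graphs\<close>

text \<open>A sum of unit vectors, not a difference: columns do not depend on the orientation chosen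
  in \<open>es\<close>.\<close>

definition incidence_matrix :: "nat \<Rightarrow> (nat \<times> nat) list \<Rightarrow> real mat" where
  "incidence_matrix n es = mat_of_cols n (map (\<lambda>(u, v). unit_vec n u + unit_vec n v) es)"

lemma incidence_matrix_carrier [simp]:
  "incidence_matrix n es \<in> carrier_mat n (length es)"
  by (intro carrier_matI) (simp_all add: incidence_matrix_def)

lemma complete_edges_eq: "complete_edges n = {E. E \<subseteq> {..<n} \<and> card E = 2}"
  by (auto simp: complete_edges_def card_2_iff)

lemma card_complete_edges: "card (complete_edges n) = n choose 2"
  using n_subsets[of "{..<n}" 2] by (simp add: complete_edges_eq)

lemma finite_complete_edges: "finite (complete_edges n)"
  by (simp add: complete_edges_eq)

lemma length_enumerates_edges:
  "enumerates_edges es E \<Longrightarrow> length es = card E"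
  unfolding enumerates_edges_def
  using distinct_card[of "map (\<lambda>(u, v). {u, v}) es"] by (simp del: set_map)

text \<open>Matrix products sum over list positions; this turns them into sums over edges, where
  counting is possible.\<close>

lemma sum_enumerates_edges:
  assumes "enumerates_edges es E"
  shows "(\<Sum>i<length es. f {fst (es ! i), snd (es ! i)}) = sum f E"
proof -
  let ?g = "\<lambda>(u, v). {u, v}"
  have "sum f E = sum_list (map f (map ?g es))"
    using assms sum_list_distinct_conv_sum_set[of "map ?g es" f]
    by (simp add: enumerates_edges_def del: set_map)
  also have "\<dots> = (\<Sum>i<length es. f {fst (es ! i), snd (es ! i)})"
    by (simp add: sum_list_sum_nth atLeast0LessThan case_prod_beta)
  finally show ?thesis by simp
qed

lemma enumerates_complete_edges_nth:
  assumes "enumerates_edges es (complete_edges n)" "i < length es" "es ! i = (u, v)"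
  shows "u < n" "v < n" "u \<noteq> v"
proof -
  have "{u, v} \<in> set (map (\<lambda>(u, v). {u, v}) es)"
    using assms(2,3) by (force simp: in_set_conv_nth)
  then have "{u, v} \<in> complete_edges n"
    using assms(1) by (simp add: enumerates_edges_def)
  then show "u < n" "v < n" "u \<noteq> v"
    by (auto simp: complete_edges_eq)
qed

lemma enumerates_edges_nth_eq_iff:
  assumes "enumerates_edges es E" "i < length es" "j < length es"
    "es ! i = (u, v)" "es ! j = (a, b)"
  shows "i = j \<longleftrightarrow> {u, v} = {a, b}"
proof -
  have "distinct (map (\<lambda>(u, v). {u, v}) es)"
    using assms(1) by (simp add: enumerates_edges_def)
  from nth_eq_iff_index_eq[OF this, of i j] show ?thesis
    using assms(2-) by simp
qed

lemma card_complete_edges_containing: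
  assumes "w < n" "w' < n"
  shows "card {E \<in> complete_edges n. w \<in> E \<and> w' \<in> E} = (if w = w' then n - 1 else 1)"
proof (cases "w = w'")
  case True
  have "{E \<in> complete_edges n. w \<in> E \<and> w' \<in> E} = (\<lambda>v. {w, v}) ` ({..<n} - {w})"
    using True assms unfolding complete_edges_def by (auto simp: doubleton_eq_iff)
  moreover have "inj_on (\<lambda>v. {w, v}) ({..<n} - {w})"
    by (auto simp: inj_on_def doubleton_eq_iff)
  ultimately show ?thesis
    using True assms by (simp add: card_image)
next
  case False
  then have "{E \<in> complete_edges n. w \<in> E \<and> w' \<in> E} = {{w, w'}}"
    using assms unfolding complete_edges_def by auto
  then show ?thesis
    using False by simp
qed

text \<open>The entry at \<open>(w, w')\<close> counts the edges containing both vertices: the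
  degree \<open>n - 1 = (n - 2) + 1\<close> on the diagonal, and the single joining edge
  elsewhere.\<close>

lemma incidence_matrix_complete:
  assumes es: "enumerates_edges es (complete_edges n)" and n: "n \<ge> 1"
  shows "incidence_matrix n es * transpose_mat (incidence_matrix n es) =
    (real n - 2) \<cdot>\<^sub>m 1\<^sub>m n + mat n n (\<lambda>_. 1)" (is "?B * _ = _")
proof (rule eq_matI)
  fix w w' assume "w < dim_row ((real n - 2) \<cdot>\<^sub>m 1\<^sub>m n + mat n n (\<lambda>_. 1 :: real))"
    "w' < dim_col ((real n - 2) \<cdot>\<^sub>m 1\<^sub>m n + mat n n (\<lambda>_. 1 :: real))"
  then have w: "w < n" "w' < n" by auto
  have dim: "dim_row ?B = n" "dim_col ?B = length es"
    using incidence_matrix_carrier[of n es] by blast+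
  \<comment> \<open>The end points of an edge differ, so no entry equals 2.\<close>
  have entry: "?B $$ (k, i) = of_bool (k \<in> {fst (es ! i), snd (es ! i)})"
    if "k < n" "i < length es" for k i
  proof -
    obtain u v where uv: "es ! i = (u, v)" by fastforce
    then show ?thesis
      using enumerates_complete_edges_nth[OF es that(2) uv] that
      by (auto simp: incidence_matrix_def mat_of_cols_index)
  qed
  have "(?B * transpose_mat ?B) $$ (w, w') = (\<Sum>i<length es. ?B $$ (w, i) * ?B $$ (w', i))"
    using w dim by (simp add: scalar_prod_def atLeast0LessThan)
  also have "\<dots> = (\<Sum>i<length es.
      (\<lambda>E. of_bool (w \<in> E \<and> w' \<in> E)) {fst (es ! i), snd (es ! i)})"
    by (rule sum.cong) (use w in \<open>auto simp: entry\<close>)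
  also have "\<dots> = (\<Sum>E\<in>complete_edges n. of_bool (w \<in> E \<and> w' \<in> E))"
    by (rule sum_enumerates_edges[OF es])
  also have "\<dots> = real (card {E \<in> complete_edges n. w \<in> E \<and> w' \<in> E})"
    using finite_complete_edges by (simp add: sum_of_bool_eq Collect_conj_eq)
  also have "\<dots> = (if w = w' then real n - 1 else 1)"
    using w n by (auto simp: card_complete_edges_containing)
  finally show "(?B * transpose_mat ?B) $$ (w, w') =
      ((real n - 2) \<cdot>\<^sub>m 1\<^sub>m n + mat n n (\<lambda>_. 1)) $$ (w, w')"
    using w by auto
qed (auto simp: incidence_matrix_def)

section \<open>The Gram matrix of the rigidity matrix\<close>

lemma scalar_prod_kron_vec:
  fixes x y a b :: "'a :: comm_semiring_1 vec"
  assumes "dim_vec x = dim_vec a" "dim_vec y = dim_vec b"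
  shows "kron_vec x y \<bullet> kron_vec a b = (x \<bullet> a) * (y \<bullet> b)"
proof -
  let ?n = "dim_vec a" and ?d = "dim_vec b"
  have "kron_vec x y \<bullet> kron_vec a b =
      (\<Sum>k<?n * ?d. (x $ (k div ?d) * y $ (k mod ?d)) * (a $ (k div ?d) * b $ (k mod ?d)))"
    using assms by (simp add: scalar_prod_def kron_vec_def atLeast0LessThan)
  also have "\<dots> = (\<Sum>i<?n. \<Sum>j\<in>{i * ?d..<i * ?d + ?d}.
      (x $ (j div ?d) * y $ (j mod ?d)) * (a $ (j div ?d) * b $ (j mod ?d)))"
    by (rule sum.nat_group[symmetric])
  also have "\<dots> = (\<Sum>i<?n. \<Sum>j<?d. (x $ i * y $ j) * (a $ i * b $ j))"
  proof (rule sum.cong[OF refl])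
    fix i assume "i \<in> {..<?n}"
    \<comment> \<open>Shifting by \<open>i * ?d\<close> makes the quotient \<open>i\<close> and the
      remainder \<open>j\<close>. This needs a positive divisor; for \<open>?d = 0\<close> both sums
      are empty.\<close>
    show "(\<Sum>j\<in>{i * ?d..<i * ?d + ?d}.
          (x $ (j div ?d) * y $ (j mod ?d)) * (a $ (j div ?d) * b $ (j mod ?d))) =
        (\<Sum>j<?d. (x $ i * y $ j) * (a $ i * b $ j))"
      using sum.shift_bounds_nat_ivl[of "\<lambda>j. (x $ (j div ?d) * y $ (j mod ?d)) *
          (a $ (j div ?d) * b $ (j mod ?d))" 0 "i * ?d" ?d]
      by (cases "?d = 0") (simp_all add: atLeast0LessThan add.commute)
  qed
  also have "\<dots> = (x \<bullet> a) * (y \<bullet> b)"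
    using assms by (simp add: scalar_prod_def sum_product atLeast0LessThan mult.assoc mult.left_commute)
  finally show ?thesis .
qed

text \<open>A polarization identity: scalar products of edge vectors depend on squared distances
  only, which is all that regularity provides.\<close>

lemma scalar_prod_diff_diff:
  fixes p q r s :: "real vec"
  assumes "p \<in> carrier_vec d" "q \<in> carrier_vec d" "r \<in> carrier_vec d" "s \<in> carrier_vec d"
  shows "2 * ((p - q) \<bullet> (r - s)) =
    (p - s) \<bullet> (p - s) + (q - r) \<bullet> (q - r) - (p - r) \<bullet> (p - r) - (q - s) \<bullet> (q - s)"
proof -
  have "2 * (\<Sum>i<d. (p $ i - q $ i) * (r $ i - s $ i)) =
    (\<Sum>i<d. (p $ i - s $ i) * (p $ i - s $ i)) + (\<Sum>i<d. (q $ i - r $ i) * (q $ i - r $ i)) -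
    (\<Sum>i<d. (p $ i - r $ i) * (p $ i - r $ i)) - (\<Sum>i<d. (q $ i - s $ i) * (q $ i - s $ i))"
    unfolding sum_distrib_left sum.distrib[symmetric] sum_subtractf[symmetric]
    by (rule sum.cong) (simp_all add: algebra_simps)
  then show ?thesis
    using assms by (simp add: scalar_prod_def atLeast0LessThan)
qed

lemma scalar_prod_unit_vec:
  assumes "u < n" "v < n"
  shows "unit_vec n u \<bullet> unit_vec n v = (of_bool (u = v) :: 'a :: semiring_1)"
  using assms by simp

lemma scalar_prod_unit_vec_diff:
  assumes "u < n" "v < n" "a < n" "b < n"
  shows "(unit_vec n u - unit_vec n v) \<bullet> (unit_vec n a - unit_vec n b) =
    (of_bool (u = a) + of_bool (v = b) - of_bool (u = b) - of_bool (v = a) :: real)"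
  using assms
  by (simp add: minus_scalar_prod_distrib[where n=n] scalar_prod_minus_distrib[where n=n]
      scalar_prod_unit_vec del: scalar_prod_left_unit scalar_prod_right_unit)

lemma scalar_prod_unit_vec_add:
  assumes "u < n" "v < n" "a < n" "b < n"
  shows "(unit_vec n u + unit_vec n v) \<bullet> (unit_vec n a + unit_vec n b) =
    (of_bool (u = a) + of_bool (v = b) + of_bool (u = b) + of_bool (v = a) :: real)"
  using assms
  by (simp add: add_scalar_prod_distrib[where n=n] scalar_prod_add_distrib[where n=n]
      scalar_prod_unit_vec del: scalar_prod_left_unit scalar_prod_right_unit)

lemma euclid_norm_pos:
  assumes "x \<in> carrier_vec d" "x \<noteq> 0\<^sub>v d"
  shows "euclid_norm x > 0"
proof -
  obtain i where "i < d" "x $ i \<noteq> 0"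
    using assms by (metis carrier_vecD eq_vecI index_zero_vec)
  then have "(\<Sum>i = 0..<d. x $ i * x $ i) > 0"
    by (intro sum_pos2[of _ i]) (auto simp: zero_less_mult_iff)
  then show ?thesis
    using assms by (simp add: euclid_norm_def scalar_prod_def)
qed

text \<open>The scalar product of two columns factors through the Kronecker product. By polarization
  the direction factor is half the incidence factor, so the result is half a square.\<close>

lemma edge_column_scalar_prod:
  assumes p: "\<And>u. u < n \<Longrightarrow> p u \<in> carrier_vec d"
    and l: "l > 0" "\<And>u v. u < n \<Longrightarrow> v < n \<Longrightarrow> u \<noteq> v \<Longrightarrow> euclid_norm (p u - p v) = l"
    and uv: "u < n" "v < n" "u \<noteq> v" and ab: "a < n" "b < n" "a \<noteq> b"
  shows "edge_column d n p (u, v) \<bullet> edge_column d n p (a, b) =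
    of_bool ({u, v} = {a, b}) +
    1 / 2 * ((unit_vec n u + unit_vec n v) \<bullet> (unit_vec n a + unit_vec n b))"
proof -
  have dist: "(p x - p y) \<bullet> (p x - p y) = l\<^sup>2 * of_bool (x \<noteq> y)" if "x < n" "y < n" for x y
  proof (cases "x = y")
    case True
    then show ?thesis using p[OF that(1)] by simp
  next
    case False
    have "l = sqrt ((p x - p y) \<bullet> (p x - p y))"
      using l(2)[OF that False] by (simp add: euclid_norm_def)
    then show ?thesis
      using False l(1) by simp
  qed
  \<comment> \<open>Since \<open>l > 0\<close>, the zero branch of \<open>edge_dir\<close> never
    occurs.\<close>
  have dir: "edge_dir d p x y = (1 / l) \<cdot>\<^sub>v (p x - p y)" if "x < n" "y < n" "x \<noteq> y" for x y
  proof -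
    have "p x \<noteq> p y"
    proof
      assume "p x = p y"
      then have "euclid_norm (p x - p y) = 0"
        using p[OF that(1)] by (simp add: euclid_norm_def)
      then show False using l that by force
    qed
    then show ?thesis using l(2)[OF that] by (simp add: edge_dir_def)
  qed
  \<comment> \<open>Up to the factor 1/2, both Kronecker factors have the same scalar product \<open>s\<close>.\<close>
  define s :: real where
    "s = of_bool (u = a) + of_bool (v = b) - of_bool (u = b) - of_bool (v = a)"
  \<comment> \<open>Each squared distance is \<open>l\<^sup>2\<close> times one minus an equality
    indicator; the four ones cancel in the polarization identity.\<close>
  have "2 * ((p u - p v) \<bullet> (p a - p b)) = l\<^sup>2 * s"
    using uv ab
    by (subst scalar_prod_diff_diff[where d=d]) (auto simp: p dist s_def algebra_simps)
  then have "(p u - p v) \<bullet> (p a - p b) = l\<^sup>2 * s / 2"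
    by simp
  moreover have "edge_dir d p u v \<bullet> edge_dir d p a b = (p u - p v) \<bullet> (p a - p b) / l\<^sup>2"
    using uv ab p[of u] p[of v] p[of a] p[of b] by (simp add: dir power2_eq_square)
  ultimately have "edge_dir d p u v \<bullet> edge_dir d p a b = s / 2"
    using l(1) by simp
  moreover have "edge_column d n p (u, v) \<bullet> edge_column d n p (a, b) =
      s * (edge_dir d p u v \<bullet> edge_dir d p a b)"
    using uv ab p[of u] p[of v] p[of a] p[of b]
    by (simp add: edge_column_def scalar_prod_kron_vec scalar_prod_unit_vec_diff s_def dir)
  ultimately have "edge_column d n p (u, v) \<bullet> edge_column d n p (a, b) = s * s / 2"
    by simp
  \<comment> \<open>For equal, adjacent and disjoint edges \<open>s\<close> is 2, 1 and 0 up to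
    sign, and the unsigned product is 2, 1 and 0. So \<open>s * s / 2\<close> is 1 + 1, 1/2 and 0,
    as claimed.\<close>
  then show ?thesis
    using uv ab by (auto simp: scalar_prod_unit_vec_add s_def doubleton_eq_iff)
qed

lemma edge_column_carrier:
  assumes "p u \<in> carrier_vec d" "p v \<in> carrier_vec d"
  shows "edge_column d n p (u, v) \<in> carrier_vec (d * n)"
proof -
  have "dim_vec (edge_dir d p u v) = d"
    using assms by (simp add: edge_dir_def)
  then show ?thesis
    by (intro carrier_vecI) (simp add: edge_column_def kron_vec_def)
qed

text \<open>Entrywise this is \<open>edge_column_scalar_prod\<close>: positions agree exactly when
  their edges do, so the indicator term there is the identity matrix.\<close>

lemma rigidity_matrix_gram:
  assumes p: "\<And>u. u < n \<Longrightarrow> p u \<in> carrier_vec d"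
    and l: "l > 0" "\<And>u v. u < n \<Longrightarrow> v < n \<Longrightarrow> u \<noteq> v \<Longrightarrow> euclid_norm (p u - p v) = l"
    and es: "enumerates_edges es (complete_edges n)"
  shows "transpose_mat (rigidity_matrix d n es p) * rigidity_matrix d n es p =
    1\<^sub>m (length es) + (1 / 2) \<cdot>\<^sub>m (transpose_mat (incidence_matrix n es) * incidence_matrix n es)"
    (is "transpose_mat ?R * _ = 1\<^sub>m ?m + _ \<cdot>\<^sub>m (transpose_mat ?B * _)")
proof (rule eq_matI)
  have dim: "dim_col ?R = ?m" "dim_col ?B = ?m"
    by (simp_all add: rigidity_matrix_def incidence_matrix_def)
  show "dim_row (transpose_mat ?R * ?R) = dim_row (1\<^sub>m ?m + (1 / 2) \<cdot>\<^sub>m (transpose_mat ?B * ?B))"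
    and "dim_col (transpose_mat ?R * ?R) = dim_col (1\<^sub>m ?m + (1 / 2) \<cdot>\<^sub>m (transpose_mat ?B * ?B))"
    by (simp_all add: dim)
  fix i j
  assume "i < dim_row (1\<^sub>m ?m + (1 / 2) \<cdot>\<^sub>m (transpose_mat ?B * ?B))"
    and "j < dim_col (1\<^sub>m ?m + (1 / 2) \<cdot>\<^sub>m (transpose_mat ?B * ?B))"
  then have ij: "i < ?m" "j < ?m" by (auto simp: incidence_matrix_def)
  obtain u v where uv: "es ! i = (u, v)" by fastforce
  obtain a b where ab: "es ! j = (a, b)" by fastforce
  note uv' = enumerates_complete_edges_nth[OF es ij(1) uv]
  note ab' = enumerates_complete_edges_nth[OF es ij(2) ab]
  have edge: "edge_column d n p (u, v) \<bullet> edge_column d n p (a, b) =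
    of_bool ({u, v} = {a, b}) +
    1 / 2 * ((unit_vec n u + unit_vec n v) \<bullet> (unit_vec n a + unit_vec n b))"
    by (rule edge_column_scalar_prod[where l=l]) (use p l uv' ab' in auto)
  have "col ?R i = edge_column d n p (u, v)" "col ?R j = edge_column d n p (a, b)"
    using ij uv ab uv' ab' p by (simp_all add: rigidity_matrix_def edge_column_carrier)
  moreover note dim
  moreover have "col ?B i = unit_vec n u + unit_vec n v" "col ?B j = unit_vec n a + unit_vec n b"
    using ij uv ab by (simp_all add: incidence_matrix_def)
  ultimately have "(transpose_mat ?R * ?R) $$ (i, j) =
      edge_column d n p (u, v) \<bullet> edge_column d n p (a, b)"
    and "(1\<^sub>m ?m + (1 / 2) \<cdot>\<^sub>m (transpose_mat ?B * ?B)) $$ (i, j) = of_bool (i = j) +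
      1 / 2 * ((unit_vec n u + unit_vec n v) \<bullet> (unit_vec n a + unit_vec n b))"
    using ij by simp_all
  then show "(transpose_mat ?R * ?R) $$ (i, j) =
      (1\<^sub>m ?m + (1 / 2) \<cdot>\<^sub>m (transpose_mat ?B * ?B)) $$ (i, j)"
    by (simp only: enumerates_edges_nth_eq_iff[OF es ij uv ab] edge)
qed

section \<open>The characteristic polynomial of the stiffness matrix\<close>

text \<open>The factors multiplying the characteristic polynomial are those that the three uses of
  \<open>det_sylvester\<close> leave on its side. Keeping them avoids division, so the identity can
  be checked at every real \<open>x\<close>, roots included.\<close>

lemma stiffness_char_poly:
  assumes p: "\<And>u. u < n \<Longrightarrow> p u \<in> carrier_vec d"
    and l: "l > 0" "\<And>u v. u < n \<Longrightarrow> v < n \<Longrightarrow> u \<noteq> v \<Longrightarrow> euclid_norm (p u - p v) = l"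
    and es: "enumerates_edges es (complete_edges n)" and n: "n \<ge> 1"
  defines "m \<equiv> length es"
  shows "char_poly (stiffness_matrix d n es p) *
      ([:0, 1:] ^ m * [:-1, 1:] ^ n * [:- real n / 2, 1:]) =
    [:0, 1:] ^ (d * n) * [:-1, 1:] ^ m * [:- real n / 2, 1:] ^ n * [:- real n, 1:]"
proof -
  let ?R = "rigidity_matrix d n es p" and ?B = "incidence_matrix n es"
  have R: "?R \<in> carrier_mat (d * n) m" "transpose_mat ?R \<in> carrier_mat m (d * n)"
    by (auto simp: rigidity_matrix_def m_def)
  have B: "?B \<in> carrier_mat n m" "transpose_mat ?B \<in> carrier_mat m n"
    by (auto simp: m_def)
  define G where "G = transpose_mat ?B * ?B"
  have G: "dim_row G = m" "dim_col G = m"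
    by (simp_all add: G_def m_def incidence_matrix_def)
  have S: "stiffness_matrix d n es p \<in> carrier_mat (d * n) (d * n)"
    using R by (auto simp: stiffness_matrix_def)
  have "poly (char_poly (stiffness_matrix d n es p)) x * (x ^ m * (x - 1) ^ n * (x - n / 2)) =
      x ^ (d * n) * (x - 1) ^ m * (x - n / 2) ^ n * (x - n)" for x :: real
  proof -
    \<comment> \<open>The values at which the next matrices are evaluated:
      \<open>x - (1 + G / 2) = (y - G) / 2\<close>, and \<open>z = y - (n - 2)\<close> absorbs the
      scalar part of \<open>?B * transpose_mat ?B\<close>.\<close>
    define y z where "y = 2 * (x - 1)" and "z = 2 * (x - n / 2)"
    have y_power: "y ^ k = 2 ^ k * (x - 1) ^ k" and z_power: "z ^ k = 2 ^ k * (x - n / 2) ^ k" for k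
      unfolding y_def z_def by (rule power_mult_distrib)+
    have z_diff: "z - n = 2 * (x - n)"
      by (simp add: z_def)
    define D where "D = det (y \<cdot>\<^sub>m 1\<^sub>m m - transpose_mat ?B * ?B)"
    have 1: "x ^ m * poly (char_poly (stiffness_matrix d n es p)) x =
        x ^ (d * n) * det (x \<cdot>\<^sub>m 1\<^sub>m m - transpose_mat ?R * ?R)"
      using det_sylvester[OF R, of x] unfolding poly_char_poly[OF S]
      by (simp only: stiffness_matrix_def)
    have gram: "transpose_mat ?R * ?R = 1\<^sub>m m + (1 / 2) \<cdot>\<^sub>m (transpose_mat ?B * ?B)"
      unfolding m_def by (rule rigidity_matrix_gram[where l=l]) (use p l es in auto)
    have "x \<cdot>\<^sub>m 1\<^sub>m m - transpose_mat ?R * ?R =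
        (1 / 2) \<cdot>\<^sub>m (y \<cdot>\<^sub>m 1\<^sub>m m - transpose_mat ?B * ?B)"
      unfolding gram G_def[symmetric] by (rule eq_matI) (auto simp: G y_def)
    then have 2: "2 ^ m * det (x \<cdot>\<^sub>m 1\<^sub>m m - transpose_mat ?R * ?R) = D"
      using G by (simp add: D_def power_one_over flip: G_def)
    have 3: "y ^ m * det (y \<cdot>\<^sub>m 1\<^sub>m n - ?B * transpose_mat ?B) = y ^ n * D"
      unfolding D_def by (rule det_sylvester[OF B])
    have "y \<cdot>\<^sub>m 1\<^sub>m n - ?B * transpose_mat ?B = z \<cdot>\<^sub>m 1\<^sub>m n - mat n n (\<lambda>_. 1)"
      unfolding incidence_matrix_complete[OF es n]
      by (rule eq_matI) (auto simp: y_def z_def)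
    then have 4: "z * det (y \<cdot>\<^sub>m 1\<^sub>m n - ?B * transpose_mat ?B) = z ^ n * (z - n)"
      using det_all_ones[of z n] by simp
    \<comment> \<open>The powers of 2 come from the halved \<open>m\<close> by \<open>m\<close>
      matrix, from \<open>y ^ n\<close> and from \<open>z\<close>. Only this nonzero constant is
      cancelled at the end.\<close>
    have "2 ^ m * 2 ^ n * 2 * (poly (char_poly (stiffness_matrix d n es p)) x *
          (x ^ m * (x - 1) ^ n * (x - n / 2))) =
        2 ^ m * (x ^ m * poly (char_poly (stiffness_matrix d n es p)) x) * y ^ n * z"
      unfolding y_power unfolding z_def by (simp only: ac_simps)
    also have "\<dots> = x ^ (d * n) * (y ^ n * D) * z"
      unfolding 1 2[symmetric] by simp
    also have "\<dots> = x ^ (d * n) * y ^ m * (z ^ n * (z - n))"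
      unfolding 3[symmetric] 4[symmetric] by simp
    also have "\<dots> = 2 ^ m * 2 ^ n * 2 *
        (x ^ (d * n) * (x - 1) ^ m * (x - n / 2) ^ n * (x - n))"
      unfolding y_power z_power z_diff by (simp only: ac_simps)
    finally show ?thesis
      by (rule mult_left_cancel[THEN iffD1, rotated]) simp
  qed
  moreover have "poly [:0, 1:] x = x" "poly [:-1, 1:] x = x - 1"
    "poly [:- real n / 2, 1:] x = x - n / 2" "poly [:- real n, 1:] x = x - n" for x :: real
    by simp_all
  \<comment> \<open>Real polynomials that agree at every point are equal.\<close>
  ultimately show ?thesis
    by (intro poly_eq_poly_eq_iff[THEN iffD1] ext) (simp only: poly_mult poly_power)
qed

section \<open>Regular simplices and the spectrum\<close>

text \<open>Regularity supplies a common edge length; its positivity follows from the distinct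
  vertices \<open>p 0\<close> and \<open>p 1\<close>.\<close>

lemma regular_simplex_dist:
  assumes "regular_simplex_vertices d S" "bij_betw p {0..<d + 1} S"
  obtains l where "l > 0"
    "\<And>u v. u < d + 1 \<Longrightarrow> v < d + 1 \<Longrightarrow> u \<noteq> v \<Longrightarrow> euclid_norm (p u - p v) = l"
proof -
  have pS: "p u \<in> S" if "u < d + 1" for u
    using assms(2) that by (auto simp: bij_betw_def)
  have inj: "p u \<noteq> p v" if "u < d + 1" "v < d + 1" "u \<noteq> v" for u v
    using assms(2) that by (auto simp: bij_betw_def inj_on_def)
  obtain l where l: "\<And>x y. x \<in> S \<Longrightarrow> y \<in> S \<Longrightarrow> x \<noteq> y \<Longrightarrow> euclid_norm (x - y) = l"
    using assms(1) by (auto simp: regular_simplex_vertices_def)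
  have S: "S \<subseteq> carrier_vec d"
    using assms(1) by (simp add: regular_simplex_vertices_def)
  show ?thesis
  proof (cases "d = 0")
    \<comment> \<open>A single vertex has no pairs, so any positive length serves.\<close>
    case True
    then show ?thesis using that[of 1] by simp
  next
    case False
    have c: "p 0 \<in> carrier_vec d" "p 1 \<in> carrier_vec d"
      using pS[of 0] pS[of 1] S False by auto
    have "p 0 \<noteq> p 1"
      using inj[of 0 1] False by simp
    then have "p 0 - p 1 \<noteq> 0\<^sub>v d"
      using c by (auto simp: vec_eq_iff)
    then have "euclid_norm (p 0 - p 1) > 0"
      using c by (intro euclid_norm_pos[of _ d]) auto
    moreover have "euclid_norm (p 0 - p 1) = l"
      by (rule l[OF pS pS inj]) (use False in simp_all)
    ultimately have "l > 0"
      by simp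
    then show ?thesis
      by (rule that) (rule l[OF pS pS inj])
  qed
qed

theorem theorem1p1:
  fixes d :: nat
    and S :: "real vec set"
    and p :: "nat \<Rightarrow> real vec"
    and es :: "(nat \<times> nat) list"
  assumes "d \<ge> 2"
    and "regular_simplex_vertices d S"
    and "bij_betw p {0..<d + 1} S"
    and "enumerates_edges es (complete_edges (d + 1))"
  shows "spectrum_mset (stiffness_matrix d (d + 1) es p) =
      replicate_mset (d * (d + 1) div 2) 0
    + replicate_mset ((d + 1) * (d - 2) div 2) 1
    + replicate_mset d ((real d + 1) / 2)
    + replicate_mset 1 (real d + 1)"
proof -
  define P where "P = char_poly (stiffness_matrix d (d + 1) es p)"
  define m where "m = d * (d + 1) div 2"
  define k where "k = (d + 1) * (d - 2) div 2"
  have p: "p u \<in> carrier_vec d" if "u < d + 1" for u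
    using assms(2,3) that by (auto simp: bij_betw_def regular_simplex_vertices_def)
  obtain l where l: "l > 0"
    "\<And>u v. u < d + 1 \<Longrightarrow> v < d + 1 \<Longrightarrow> u \<noteq> v \<Longrightarrow> euclid_norm (p u - p v) = l"
    using regular_simplex_dist[OF assms(2,3)] by blast
  have m: "length es = m"
    using length_enumerates_edges[OF assms(4)]
    by (simp add: card_complete_edges choose_two m_def mult.commute)
  \<comment> \<open>This substitution removes the natural subtraction in
    \<open>d - 2\<close>.\<close>
  obtain e where e: "d = e + 2"
    using assms(1) by (metis le_add_diff_inverse2)
  \<comment> \<open>The halving in \<open>m\<close> is exact, so the factor
    \<open>x ^ (d * n)\<close> is \<open>x ^ (m + m)\<close>; after cancelling \<open>x ^ m\<close>
    the eigenvalue 0 keeps multiplicity \<open>m\<close>.\<close>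
  have dm: "d * (d + 1) = m + m"
    unfolding m_def by (metis dvd_mult_div_cancel even_mult_iff even_plus_one_iff mult_2)
  \<comment> \<open>This product is \<open>(d - 2) * (d + 1)\<close>, so the halving in
    \<open>k\<close> is exact too. Then \<open>k\<close> is what remains of the exponent
    \<open>m\<close> of \<open>x - 1\<close> after cancelling \<open>d + 1\<close> factors.\<close>
  have "even (e * (e + 3))" by simp
  then have mk: "m = k + (d + 1)"
    unfolding m_def k_def e by (auto simp: algebra_simps elim!: evenE)
  have "P * ([:0, 1:] ^ m * [:-1, 1:] ^ (d + 1) * [:- real (d + 1) / 2, 1:]) =
      [:0, 1:] ^ (m + m) * [:-1, 1:] ^ m * [:- real (d + 1) / 2, 1:] ^ (d + 1) *
      [:- real (d + 1), 1:]"
    using stiffness_char_poly[where p=p, OF p l assms(4)] unfolding m P_def dm by simp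
  then have "P * ([:0, 1:] ^ m * [:-1, 1:] ^ (d + 1) * [:- real (d + 1) / 2, 1:]) =
      [:0, 1:] ^ m * [:-1, 1:] ^ k * [:- real (d + 1) / 2, 1:] ^ d * [:- real (d + 1), 1:] *
      ([:0, 1:] ^ m * [:-1, 1:] ^ (d + 1) * [:- real (d + 1) / 2, 1:])"
    unfolding mk by (simp only: power_add power_one_right ac_simps)
  \<comment> \<open>The common factor is cancelled in the polynomial ring, where being nonzero
    suffices.\<close>
  moreover have "[:0, 1:] ^ m * [:-1, 1:] ^ (d + 1) * [:- real (d + 1) / 2, 1:] \<noteq> 0"
    unfolding mult_eq_0_iff power_eq_0_iff by simp
  ultimately have "P = [:0, 1:] ^ m * [:-1, 1:] ^ k * [:- real (d + 1) / 2, 1:] ^ d *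
      [:- real (d + 1), 1:]"
    by (metis mult_right_cancel)
  \<comment> \<open>For nonzero factors \<open>proots\<close> sends products to multiset sums, so
    each power of a linear factor contributes its root with the exponent as multiplicity.\<close>
  then show ?thesis
    unfolding spectrum_mset_def P_def[symmetric] m_def[symmetric] k_def[symmetric]
    by (simp only: proots_mult mult_eq_0_iff power_eq_0_iff pCons_eq_0_iff one_neq_zero simp_thms)
      (simp add: proots_power add_divide_distrib diff_divide_distrib add.commute)
qed

end
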